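(* Let $\mathbb F_q$ be a finite field of characteristic $p$, $\mathbf w=(w_0,\dots,w_n)$ a vector of positive integers and $T=\{0,\dots,n\}$. The twist zeta function $Z_{\mathrm{tw}}(\mathcal P_{\mathbf w},t)=\exp\bigl(\sum_{r\ge1}A_{\mathbf w}(q^r)\,t^r/r\bigr)$ is a rational function of $t$. More precisely, $$Z_{\mathrm{tw}}(\mathcal P_{\mathbf w},t)=\prod_{\emptyset\ne S\subseteq T}\ \prod_{m\in\mathcal D(k_S)}\ \prod_{j=0}^{|S|-1}\bigl(1-(q^jt)^{o_m}\bigr)^{-c(S,m,j)},\qquad c(S,m,j)=\frac{\varphi(m)}{o_m}\binom{|S|-1}{j}(-1)^{|S|-1-j},$$ and the exponents $c(S,m,j)$ are integers.
   Context: For $r\ge 1$, $A_{\mathbf w}(q^r)$ is the number of orbits of $\mathbb F_{q^r}^\times$ on $\mathbb F_{q^r}^{n+1}\setminus\{0\}$ under $\lambda\cdot(x_0,\dots,x_n)=(\lambda^{w_0}x_0,\dots,\lambda^{w_n}x_n)$. For nonempty $S\subseteq T$, $k_S=\gcd\{w_i:i\in S\}$. For a positive integer $k$, $\mathcal D(k)=\{m\ge 1: m\mid k,\ p\nmid m\}$. For $m$ prime to $p$, $o_m=\operatorname{ord}_m(q)$ is the multiplicative order of $q$ modulo $m$, with $o_1=1$. $\varphi$ is Euler's totient function. $\mathcal P_{\mathbf w}=[(\mathbb A^{n+1}\setminus\{0\})/\mathbb G_m]$ is the weighted projective stack (it enters only through the numbers $A_{\mathbf w}(q^r)$). *)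

theory Defs
  imports
    "HOL-Algebra.Algebraic_Closure_Type"
    "HOL-Computational_Algebra.Computational_Algebra"
    "HOL-Number_Theory.Number_Theory"
    "HOL-Library.Cardinality"
begin

text \<open>
  Throughout, \<^typ>\<open>'a\<close> is the finite base field with $q$ = \<^term>\<open>CARD('a)\<close> elements.
  Its extension of degree $r$ is realised inside the algebraic closure as the set of
  roots of $x^{q^r} - x$; the lemmas below confirm that for $r \geq 1$ this is a subfield
  with $q^r$ elements.
\<close>

definition field_ext :: "nat \<Rightarrow> 'a :: finite_field alg_closure set" where
  "field_ext r = {x. x ^ (CARD('a) ^ r) = x}"

lemma to_ac_in_field_ext: "to_ac (x :: 'a :: finite_field) \<in> field_ext r"
  by (simp add: field_ext_def finite_field_power_card_power_eq_same flip: to_ac_power)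

lemma add_power_CARD:
  fixes x y :: "'a :: finite_field alg_closure"
  shows "(x + y) ^ CARD('a) = x ^ CARD('a) + y ^ CARD('a)"
proof -
  define q where "q = CARD('a)"
  have q: "q > 0"
    by (simp add: q_def finite_UNIV_card_ge_0)
  define f :: "'a poly" where "f = (\<Sum>k\<in>{1..<q}. monom (of_nat (q choose k)) k)"
  have split: "(a + b) ^ q = a ^ q + b ^ q + (\<Sum>k\<in>{1..<q}. of_nat (q choose k) * a ^ k * b ^ (q - k))"
    for a b :: "'c :: comm_ring_1"
  proof -
    have "{..q} = insert 0 (insert q {1..<q})"
      using q by auto
    thus ?thesis
      unfolding binomial_ring using q by (simp add: algebra_simps)
  qed
  have "f = 0"
  proof (rule ccontr)
    assume "f \<noteq> 0"
    have "poly f a = 0" for a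
      using split[of a 1]
      by (simp add: f_def poly_sum poly_monom q_def finite_field_power_card_eq_same algebra_simps)
    hence "q = card {a. poly f a = 0}"
      by (simp add: q_def)
    also have "\<dots> \<le> degree f"
      by (rule card_poly_roots_bound) fact
    also have "degree f < q"
      unfolding f_def using q
      by (intro degree_sum_less) (auto intro!: le_less_trans[OF degree_monom_le])
    finally show False by simp
  qed
  have "of_nat (q choose k) = (0 :: 'a alg_closure)" if "k \<in> {1..<q}" for k
  proof -
    have "coeff f k = of_nat (q choose k)"
      using that by (simp add: f_def coeff_sum if_distrib)
    hence "of_nat (q choose k) = (0 :: 'a)"
      using \<open>f = 0\<close> by simp
    thus ?thesis
      by (simp add: of_nat_eq_0_iff_char_dvd)
  qed
  thus ?thesis
    using split[of x y] by (simp add: q_def)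
qed

lemma field_ext_subfield:
  fixes x y :: "'a :: finite_field alg_closure"
  assumes "x \<in> field_ext r" "y \<in> field_ext r"
  shows "x + y \<in> field_ext r" "- x \<in> field_ext r" "x * y \<in> field_ext r" "inverse x \<in> field_ext r"
proof -
  have add: "(a + b) ^ (CARD('a) ^ s) = a ^ (CARD('a) ^ s) + b ^ (CARD('a) ^ s)"
    for a b :: "'a alg_closure" and s
    by (induction s arbitrary: a b) (simp_all add: power_mult add_power_CARD)
  show "x + y \<in> field_ext r" "x * y \<in> field_ext r" "inverse x \<in> field_ext r"
    using assms by (simp_all add: field_ext_def add power_mult_distrib power_inverse)
  have "(- x) ^ (CARD('a) ^ r) = - (x ^ (CARD('a) ^ r))"
    using add[of "- x" x r] by (simp add: power_0_left eq_neg_iff_add_eq_0)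
  thus "- x \<in> field_ext r"
    using assms by (simp add: field_ext_def)
qed

lemma card_field_ext:
  assumes "r \<ge> 1"
  shows "card (field_ext r :: 'a :: finite_field alg_closure set) = CARD('a) ^ r"
proof -
  define N where "N = CARD('a) ^ r"
  have "{0, 1 :: 'a} \<subseteq> UNIV" "finite (UNIV :: 'a set)" by auto
  hence "card {0, 1 :: 'a} \<le> CARD('a)"
    by (intro card_mono) auto
  hence q: "CARD('a) \<ge> 2" by simp
  hence N: "N \<ge> 2"
    unfolding N_def using assms self_le_power[of "CARD('a)" r] by linarith
  define f :: "'a alg_closure poly" where "f = monom 1 N - monom 1 1"
  have deg: "degree f = N"
    unfolding f_def diff_conv_add_uminus using N
    by (subst degree_add_eq_left) (auto simp: degree_monom_eq)
  hence f0: "f \<noteq> 0"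
    using N by auto
  obtain A where A: "size A = degree f" "f = smult (lead_coeff f) (\<Prod>x\<in>#A. [:-x, 1:])"
    using alg_closed_imp_factorization[OF f0] by blast
  have "CHAR('a) dvd N"
    unfolding N_def using assms CHAR_dvd_CARD[where ?'a = 'a] by (simp add: dvd_power_iff dvd_trans dvd_power)
  hence "of_nat N = (0 :: 'a alg_closure)"
    by (simp add: of_nat_eq_0_iff_char_dvd)
  hence der: "pderiv f = [:-1:]"
    by (simp add: f_def pderiv_diff pderiv_monom monom_0)
  have "count A x \<le> 1" for x
  proof (rule ccontr)
    assume "\<not> count A x \<le> 1"
    hence "{#x, x#} \<subseteq># A"
      by (simp add: subseteq_mset_def)
    then obtain B where "A = {#x, x#} + B"
      by (metis subset_mset.le_iff_add)
    hence feq: "f = [:-x, 1:] * ([:-x, 1:] * smult (lead_coeff f) (\<Prod>x\<in>#B. [:-x, 1:]))"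
      using A(2) by (simp add: mult.assoc)
    hence "poly (pderiv f) x = 0"
      by (subst feq, subst pderiv_mult) simp
    thus False
      by (simp add: der)
  qed
  moreover have "count A x \<ge> 1" if "x \<in># A" for x
    using that by (simp add: Suc_le_eq)
  ultimately have "count A x = 1" if "x \<in># A" for x
    using that by (simp add: order.antisym)
  hence "A = mset_set (set_mset A)"
    by (intro multiset_eqI) (simp add: count_mset_set' not_in_iff)
  hence "size A = card (set_mset A)"
    by (metis size_mset_set)
  moreover have "set_mset A = {x. poly f x = 0}"
    using f0 by (subst A(2)) (auto simp: poly_prod_mset prod_mset_zero_iff)
  moreover have "{x. poly f x = 0} = field_ext r"
    by (auto simp: f_def field_ext_def N_def poly_monom)
  ultimately show ?thesis
    using A(1) deg by (simp add: N_def)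
qed

text \<open>
  A vector $(x_0, \ldots, x_n)$ is a function on \<^term>\<open>{0..n}\<close>, made unique by the value
  \<^term>\<open>undefined\<close> elsewhere (as in \<^const>\<open>PiE\<close>).
\<close>

definition nonzero_vectors :: "'b :: zero set \<Rightarrow> nat \<Rightarrow> (nat \<Rightarrow> 'b) set" where
  "nonzero_vectors K n = ({0..n} \<rightarrow>\<^sub>E K) - {\<lambda>i\<in>{0..n}. 0}"

definition weighted_act ::
    "(nat \<Rightarrow> nat) \<Rightarrow> nat \<Rightarrow> 'b :: monoid_mult \<Rightarrow> (nat \<Rightarrow> 'b) \<Rightarrow> (nat \<Rightarrow> 'b)" where
  "weighted_act w n l x = (\<lambda>i\<in>{0..n}. l ^ w i * x i)"

definition weighted_orbit ::
    "(nat \<Rightarrow> nat) \<Rightarrow> nat \<Rightarrow> 'b :: field set \<Rightarrow> (nat \<Rightarrow> 'b) \<Rightarrow> (nat \<Rightarrow> 'b) set" where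
  "weighted_orbit w n K x = (\<lambda>l. weighted_act w n l x) ` (K - {0})"

definition twist_count :: "'a :: finite_field itself \<Rightarrow> (nat \<Rightarrow> nat) \<Rightarrow> nat \<Rightarrow> nat \<Rightarrow> nat" where
  "twist_count F w n r =
     (let K = (field_ext r :: 'a alg_closure set)
      in card (weighted_orbit w n K ` nonzero_vectors K n))"

text \<open>
  As a formal power series over the rationals; the exponential of a series with zero constant
  term is its composition into \<^term>\<open>fps_exp 1\<close>.
\<close>

definition twist_zeta :: "'a :: finite_field itself \<Rightarrow> (nat \<Rightarrow> nat) \<Rightarrow> nat \<Rightarrow> rat fps" where
  "twist_zeta F w n =
     fps_exp 1 oo Abs_fps (\<lambda>r. if r = 0 then 0 else of_nat (twist_count F w n r) / of_nat r)"

definition rational_fps :: "'b :: field fps \<Rightarrow> bool" where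
  "rational_fps f \<longleftrightarrow> (\<exists>P Q. Q \<noteq> 0 \<and> f * fps_of_poly Q = fps_of_poly P)"

definition weight_gcd :: "(nat \<Rightarrow> nat) \<Rightarrow> nat set \<Rightarrow> nat" where
  "weight_gcd w S = Gcd (w ` S)"

definition prime_to_divisors :: "nat \<Rightarrow> nat \<Rightarrow> nat set" where
  "prime_to_divisors p k = {m. m \<ge> 1 \<and> m dvd k \<and> \<not> p dvd m}"

text \<open>
  The exponent $c(S, m, j)$ is a rational number here, as its integrality is part of the claim.
\<close>

definition twist_exponent :: "nat \<Rightarrow> nat set \<Rightarrow> nat \<Rightarrow> nat \<Rightarrow> rat" where
  "twist_exponent q S m j =
     of_nat (totient m) / of_nat (ord m q) * of_nat ((card S - 1) choose j)
       * (-1) ^ (card S - 1 - j)"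

end

theory Submission
  imports Defs "HOL-Algebra.Sylow"
begin

text \<open>
  Put $N = q^r - 1$. A vector with support $S$ has as stabiliser the $k_S$-torsion of the units,
  which has $\gcd(k_S, N)$ elements, so the $N^{|S|}$ vectors with support $S$ form
  $N^{|S|-1} \gcd(k_S, N)$ orbits. Now $\gcd(k_S, N)$ is the sum of $\varphi(m)$ over the
  common divisors $m$, that is, over those $m \in \mathcal{D}(k_S)$ with $o_m \mid r$. Expanding
  $(q^r - 1)^{|S|-1}$ turns $\sum_r A_{\mathbf w}(q^r) t^r / r$ into a combination, with the
  integral coefficients $c(S, m, j)$, of the series $- \log (1 - (q^j t)^{o_m})$.
\<close>

section \<open>Roots of unity\<close>

text \<open>Bezout in the form \<open>a * u = b * v + gcd a b\<close> keeps all exponents natural,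
  so no inverse of \<open>x\<close> is needed. It asks for \<open>a\<close> nonzero; for
  \<open>a = 0\<close> the gcd is \<open>b\<close>.\<close>

lemma power_gcd_eq_1_iff:
  fixes x :: "'b :: field"
  shows "x ^ gcd a b = 1 \<longleftrightarrow> x ^ a = 1 \<and> x ^ b = 1"
proof
  assume "x ^ gcd a b = 1"
  thus "x ^ a = 1 \<and> x ^ b = 1"
    by (metis dvd_def gcd_dvd1 gcd_dvd2 power_mult power_one)
next
  assume *: "x ^ a = 1 \<and> x ^ b = 1"
  show "x ^ gcd a b = 1"
  proof (cases "a = 0")
    case False
    then obtain u v where "a * u = b * v + gcd a b"
      using bezout_nat by blast
    hence "x ^ (a * u) = x ^ (b * v) * x ^ gcd a b"
      by (simp add: power_add)
    thus ?thesis using * by (simp add: power_mult)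
  qed (use * in simp)
qed

lemma power_Gcd_eq_1_iff:
  fixes x :: "'b :: field"
  assumes "finite A"
  shows "x ^ Gcd A = 1 \<longleftrightarrow> (\<forall>a\<in>A. x ^ a = 1)"
  using assms by (induction A rule: finite_induct) (simp_all add: power_gcd_eq_1_iff)

text \<open>The polynomial X^N - 1 factors as (X^g - 1) R with R of degree N - g. Its N distinct
  roots are shared by two factors having at most g and N - g roots, so both bounds are attained.
  This gives the size of the torsion without using that the unit group is cyclic.\<close>

lemma card_roots_of_unity_dvd:
  assumes N: "card {x :: 'b :: field. x ^ N = 1} = N" "N > 0" and g: "g dvd N"
  shows "card {x :: 'b. x ^ g = 1} = g"
proof -
  have g0: "g > 0"
    using N(2) g by (simp add: dvd_pos_nat)
  obtain h where h: "N = g * h"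
    using g by (elim dvdE)
  hence h0: "h > 0" using N(2) by simp
  define P where "P = (monom 1 g - 1 :: 'b poly)"
  define R where "R = (\<Sum>i<h. monom 1 (g * i) :: 'b poly)"
  have PR: "P * R = monom 1 N - 1"
  proof -
    have "P * R = (monom 1 g - 1) * (\<Sum>i<h. monom 1 g ^ i)"
      by (simp add: P_def R_def monom_power)
    also have "\<dots> = monom 1 g ^ h - 1"
      by (rule power_diff_1_eq [symmetric])
    finally show ?thesis by (simp add: monom_power h)
  qed
  have deg: "degree (monom 1 k - 1 :: 'b poly) = k" if "k > 0" for k
    using that unfolding diff_conv_add_uminus
    by (subst degree_add_eq_left) (auto simp: degree_monom_eq)
  have ne: "monom 1 N - 1 \<noteq> (0 :: 'b poly)"
    using deg[OF N(2)] N(2) by auto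
  hence P0: "P \<noteq> 0" and R0: "R \<noteq> 0"
    using PR by auto
  have dPR: "degree P + degree R = N"
    using degree_mult_eq[OF P0 R0] PR deg[OF N(2)] by simp
  have rP: "{x. poly P x = 0} = {x. x ^ g = 1}"
    by (auto simp: P_def poly_monom)
  have "{x. x ^ N = 1} = {x. poly (P * R) x = 0}"
    by (auto simp: PR poly_monom)
  also have "\<dots> = {x. poly P x = 0} \<union> {x. poly R x = 0}"
    by auto
  finally have "N \<le> card {x. poly P x = 0} + card {x. poly R x = 0}"
    using N(1) card_Un_le by metis
  moreover have "card {x. poly P x = 0} \<le> degree P" "card {x. poly R x = 0} \<le> degree R"
    using P0 R0 by (auto intro: card_poly_roots_bound)
  moreover have "degree P = g"
    using deg[OF g0] by (simp add: P_def)
  ultimately show ?thesis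
    using dPR rP by simp
qed

section \<open>Orbits with given support\<close>

text \<open>The product form lets the cardinality be read off factor by factor;
  \<open>support_vectors_iff\<close> recovers the description by supports.\<close>

definition support_vectors :: "'b :: zero set \<Rightarrow> nat \<Rightarrow> nat set \<Rightarrow> (nat \<Rightarrow> 'b) set" where
  "support_vectors K n S = (\<Pi>\<^sub>E i\<in>{0..n}. if i \<in> S then K - {0} else {0})"

lemma support_vectors_iff:
  assumes "S \<subseteq> {0..n}" "0 \<in> K"
  shows "x \<in> support_vectors K n S \<longleftrightarrow>
    x \<in> {0..n} \<rightarrow>\<^sub>E K \<and> S = {i \<in> {0..n}. x i \<noteq> 0}"
  using assms unfolding support_vectors_def PiE_iff by (auto split: if_splits)

lemma card_support_vectors:
  assumes "S \<subseteq> {0..n}"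
  shows "card (support_vectors K n S) = card (K - {0}) ^ card S"
proof -
  have "card (support_vectors K n S) = (\<Prod>i\<in>{0..n}. if i \<in> S then card (K - {0}) else 1)"
    unfolding support_vectors_def by (subst card_PiE) (auto intro!: prod.cong)
  also have "\<dots> = (\<Prod>i\<in>S. card (K - {0}))"
    using assms by (simp add: prod.If_cases Int_absorb1)
  finally show ?thesis by simp
qed

lemma nonzero_vectors_eq:
  assumes "0 \<in> K"
  shows "nonzero_vectors K n = (\<Union>S\<in>{S. S \<subseteq> {0..n} \<and> S \<noteq> {}}. support_vectors K n S)"
proof (intro equalityI subsetI)
  fix x assume x: "x \<in> nonzero_vectors K n"
  have "{i \<in> {0..n}. x i \<noteq> 0} \<noteq> {}"
  proof
    assume "{i \<in> {0..n}. x i \<noteq> 0} = {}"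
    hence "x = (\<lambda>i\<in>{0..n}. 0)"
      using x by (intro ext) (auto simp: nonzero_vectors_def PiE_iff extensional_def)
    thus False using x by (simp add: nonzero_vectors_def)
  qed
  moreover have "x \<in> support_vectors K n {i \<in> {0..n}. x i \<noteq> 0}"
    using x assms by (subst support_vectors_iff) (auto simp: nonzero_vectors_def)
  ultimately show "x \<in> (\<Union>S\<in>{S. S \<subseteq> {0..n} \<and> S \<noteq> {}}. support_vectors K n S)"
    by (intro UN_I[of "{i \<in> {0..n}. x i \<noteq> 0}"]) auto
next
  fix x assume "x \<in> (\<Union>S\<in>{S. S \<subseteq> {0..n} \<and> S \<noteq> {}}. support_vectors K n S)"
  then obtain S where S: "S \<subseteq> {0..n}" "S \<noteq> {}" "x \<in> support_vectors K n S" by auto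
  hence "x \<in> {0..n} \<rightarrow>\<^sub>E K" "S = {i \<in> {0..n}. x i \<noteq> 0}"
    using support_vectors_iff[OF S(1) assms] by auto
  thus "x \<in> nonzero_vectors K n"
    using S(2) by (auto simp: nonzero_vectors_def)
qed

text \<open>
  The multiplicative group of the field enters only as the full group of \<open>N\<close>-th roots of
  unity, so that no closure properties of \<open>K\<close> have to be assumed.
\<close>

locale roots_of_unity_action =
  fixes K :: "'b :: field set" and N :: nat and w :: "nat \<Rightarrow> nat" and n :: nat
  assumes zero_in: "0 \<in> K" and units: "K - {0} = {x. x ^ N = 1}"
    and card_units: "card (K - {0}) = N" and N_pos: "N > 0"
begin

lemma finite_units: "finite (K - {0})"
  using card_units N_pos card_gt_0_iff by metis

lemma units_closed:
  assumes "x \<in> K - {0}" "y \<in> K - {0}"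
  shows "x * y \<in> K - {0}" "x / y \<in> K - {0}"
  using assms unfolding units by (simp_all add: power_mult_distrib power_divide)

lemma finite_support_vectors: "finite (support_vectors K n S)"
  unfolding support_vectors_def by (intro finite_PiE) (use finite_units in auto)

lemma act_in_support_vectors:
  assumes S: "S \<subseteq> {0..n}" and x: "x \<in> support_vectors K n S" and l: "l \<in> K - {0}"
  shows "weighted_act w n l x \<in> support_vectors K n S"
proof -
  have "(l ^ w i) ^ N = 1" for i
    using l power_mult[of l N "w i"] power_mult[of l "w i" N] unfolding units
    by (simp add: mult.commute)
  hence lw: "l ^ w i \<in> K - {0}" for i
    unfolding units by simp
  show ?thesis
    using x units_closed(1)[OF lw]
    by (auto simp: support_vectors_def weighted_act_def PiE_iff split: if_splits)
qed

lemma act_act: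
  "weighted_act w n l (weighted_act w n m x) = weighted_act w n (l * m) x"
  for l m :: 'b
  by (intro ext) (simp add: weighted_act_def power_mult_distrib mult.assoc)

text \<open>The fibres of the map from vectors to orbits are the orbits themselves, which is what
  the double count of orbits uses. A vector lies in its own orbit through the scalar 1, and
  multiplication by \<open>l\<close> permutes the units.\<close>

lemma orbit_eq:
  assumes S: "S \<subseteq> {0..n}" and x: "x \<in> support_vectors K n S"
  shows "{y \<in> support_vectors K n S. weighted_orbit w n K y = weighted_orbit w n K x}
    = weighted_orbit w n K x"
proof (intro equalityI subsetI)
  fix y assume y: "y \<in> {y \<in> support_vectors K n S. weighted_orbit w n K y = weighted_orbit w n K x}"
  hence "weighted_act w n 1 y = y"
    by (auto simp: weighted_act_def support_vectors_def PiE_iff extensional_def)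
  moreover have "1 \<in> K - {0}" unfolding units by simp
  ultimately have "y \<in> weighted_orbit w n K y"
    unfolding weighted_orbit_def by (metis image_eqI)
  thus "y \<in> weighted_orbit w n K x" using y by simp
next
  fix y assume "y \<in> weighted_orbit w n K x"
  then obtain l where l: "l \<in> K - {0}" "y = weighted_act w n l x"
    by (auto simp: weighted_orbit_def)
  have "weighted_orbit w n K y = (\<lambda>m. weighted_act w n m x) ` ((\<lambda>m. m * l) ` (K - {0}))"
    by (simp add: weighted_orbit_def l(2) act_act image_image)
  also have "(\<lambda>m. m * l) ` (K - {0}) = K - {0}"
  proof (intro equalityI subsetI)
    fix m assume "m \<in> K - {0}"
    moreover from this have "m / l \<in> K - {0}" using l units_closed(2) by blast
    ultimately show "m \<in> (\<lambda>m. m * l) ` (K - {0})"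
      using l(1) by (intro image_eqI[of _ _ "m / l"]) auto
  qed (use l units_closed in auto)
  finally have "weighted_orbit w n K y = weighted_orbit w n K x"
    by (simp add: weighted_orbit_def)
  thus "y \<in> {y \<in> support_vectors K n S. weighted_orbit w n K y = weighted_orbit w n K x}"
    using act_in_support_vectors[OF S x l(1)] l(2) by simp
qed

text \<open>Every unit is an N-th root of unity, so its \<open>k\<close>-torsion condition amounts
  to being a root of unity of order dividing \<open>gcd k N\<close>.\<close>

lemma card_torsion: "card {x \<in> K - {0}. x ^ k = 1} = gcd k N"
proof -
  have "{x \<in> K - {0}. x ^ k = 1} = {x. x ^ gcd k N = 1}"
    unfolding units by (auto simp: power_gcd_eq_1_iff)
  thus ?thesis
    using card_roots_of_unity_dvd[of N "gcd k N"] card_units N_pos units by simp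
qed

text \<open>Coordinates in the support cancel and the others compare 0 with 0. Hence the stabiliser
  of \<open>x\<close> is the \<open>weight_gcd w S\<close>-torsion of the units.\<close>

lemma act_eq_iff:
  assumes S: "S \<subseteq> {0..n}" and x: "x \<in> support_vectors K n S"
    and l: "l \<in> K - {0}" "m \<in> K - {0}"
  shows "weighted_act w n l x = weighted_act w n m x \<longleftrightarrow> (l / m) ^ weight_gcd w S = 1"
proof -
  have Sx: "S = {i \<in> {0..n}. x i \<noteq> 0}"
    using x support_vectors_iff[OF S zero_in] by blast
  have "weighted_act w n l x = weighted_act w n m x \<longleftrightarrow>
      (\<forall>i\<in>{0..n}. l ^ w i * x i = m ^ w i * x i)"
    by (auto simp: weighted_act_def restrict_def fun_eq_iff)
  also have "\<dots> \<longleftrightarrow> (\<forall>i\<in>S. l ^ w i = m ^ w i)"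
    by (subst Sx) auto
  also have "\<dots> \<longleftrightarrow> (\<forall>i\<in>S. (l / m) ^ w i = 1)"
    using l by (auto simp: power_divide)
  also have "\<dots> \<longleftrightarrow> (l / m) ^ weight_gcd w S = 1"
    using finite_subset[OF S] by (simp add: weight_gcd_def power_Gcd_eq_1_iff)
  finally show ?thesis .
qed

text \<open>Orbit-stabiliser by counting: each fibre of the map from \<open>l\<close> to its action
  on \<open>x\<close> is a coset of the torsion, and the fibres partition the N units.\<close>

lemma card_orbit:
  assumes S: "S \<subseteq> {0..n}" and x: "x \<in> support_vectors K n S"
  shows "card (weighted_orbit w n K x) * gcd (weight_gcd w S) N = N"
proof -
  define f where "f = (\<lambda>l. weighted_act w n l x)"
  define k where "k = weight_gcd w S"
  have fib: "card {l \<in> K - {0}. f l = y} = gcd k N" if y: "y \<in> f ` (K - {0})" for y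
  proof -
    obtain m where m: "m \<in> K - {0}" "y = f m" using y by blast
    have "{l \<in> K - {0}. f l = y} = (\<lambda>g. m * g) ` {x \<in> K - {0}. x ^ k = 1}"
    proof (intro equalityI subsetI)
      fix l assume l: "l \<in> {l \<in> K - {0}. f l = y}"
      hence "(l / m) ^ k = 1"
        using act_eq_iff[OF S x _ m(1), of l] by (simp add: f_def m(2) k_def)
      moreover have "l / m \<in> K - {0}" using l units_closed(2)[OF _ m(1)] by blast
      ultimately show "l \<in> (\<lambda>g. m * g) ` {x \<in> K - {0}. x ^ k = 1}"
        using m(1) by (intro image_eqI[of _ _ "l / m"]) auto
    next
      fix l assume "l \<in> (\<lambda>g. m * g) ` {x \<in> K - {0}. x ^ k = 1}"
      then obtain g where g: "g \<in> K - {0}" "g ^ k = 1" "l = m * g" by auto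
      have "l \<in> K - {0}" using g(3) units_closed(1)[OF m(1) g(1)] by simp
      moreover have "(l / m) ^ k = 1" using g m(1) by simp
      ultimately show "l \<in> {l \<in> K - {0}. f l = y}"
        using act_eq_iff[OF S x _ m(1), of l] m(2) by (simp add: f_def k_def)
    qed
    moreover have "inj_on (\<lambda>g. m * g) {x \<in> K - {0}. x ^ k = 1}"
      using m by (auto simp: inj_on_def)
    ultimately show ?thesis by (simp only: card_image card_torsion)
  qed
  have "N = (\<Sum>l\<in>K - {0}. 1)" by (simp only: card_units flip: card_eq_sum)
  also have "\<dots> = (\<Sum>y\<in>f ` (K - {0}). \<Sum>l\<in>{l \<in> K - {0}. f l = y}. 1)"
    by (rule sum.image_gen[OF finite_units])
  also have "\<dots> = (\<Sum>y\<in>f ` (K - {0}). gcd k N)"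
    by (intro sum.cong refl) (simp only: fib flip: card_eq_sum)
  finally show ?thesis
    by (simp add: weighted_orbit_def f_def k_def)
qed

text \<open>Orbit sizes add up to N^|S|, and each of them multiplied by the stabiliser order is
  N.\<close>

lemma card_support_orbits:
  assumes S: "S \<subseteq> {0..n}" "S \<noteq> {}"
  shows "card (weighted_orbit w n K ` support_vectors K n S)
    = N ^ (card S - 1) * gcd (weight_gcd w S) N"
proof -
  let ?V = "support_vectors K n S" and ?o = "weighted_orbit w n K"
  define g where "g = gcd (weight_gcd w S) N"
  have g0: "g > 0" using N_pos by (simp add: g_def)
  have s0: "card S > 0" using S finite_subset[OF S(1)] by (simp add: card_gt_0_iff)
  have "N ^ card S * g = (\<Sum>x\<in>?V. 1) * g"
    using card_support_vectors[OF S(1), of K] card_units by simp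
  also have "(\<Sum>x\<in>?V. 1) = (\<Sum>y\<in>?o ` ?V. \<Sum>x\<in>{x \<in> ?V. ?o x = y}. 1)"
    by (rule sum.image_gen[OF finite_support_vectors])
  also have "\<dots> = (\<Sum>y\<in>?o ` ?V. card y)"
    using orbit_eq[OF S(1)] by (intro sum.cong refl) auto
  also have "\<dots> * g = (\<Sum>y\<in>?o ` ?V. N)"
    unfolding sum_distrib_right g_def using card_orbit[OF S(1)] by (intro sum.cong refl) auto
  also have "\<dots> = card (?o ` ?V) * N" by simp
  \<comment> \<open>As \<open>S\<close> is nonempty, one factor N can be split off from N^|S|; it
    then cancels.\<close>
  finally have "card (?o ` ?V) * N = N ^ (card S - 1) * g * N"
    unfolding power_minus_mult[OF s0, of N, symmetric] by (simp only: mult_ac)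
  thus ?thesis using N_pos by (simp add: g_def)
qed

text \<open>The action preserves supports, so different supports contribute disjoint families of
  orbits.\<close>

lemma card_orbits:
  "card (weighted_orbit w n K ` nonzero_vectors K n) =
    (\<Sum>S\<in>{S. S \<subseteq> {0..n} \<and> S \<noteq> {}}. N ^ (card S - 1) * gcd (weight_gcd w S) N)"
proof -
  let ?I = "{S. S \<subseteq> {0..n} \<and> S \<noteq> {}}" and ?o = "weighted_orbit w n K"
  have disj: "?o ` support_vectors K n S \<inter> ?o ` support_vectors K n S' = {}"
    if "S \<in> ?I" "S' \<in> ?I" "S \<noteq> S'" for S S'
  proof (rule ccontr)
    assume "?o ` support_vectors K n S \<inter> ?o ` support_vectors K n S' \<noteq> {}"
    then obtain x x' where x: "x \<in> support_vectors K n S" "x' \<in> support_vectors K n S'"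
      "?o x = ?o x'" by blast
    have "x \<in> ?o x" using orbit_eq[of S x] x(1) that by blast
    hence "x \<in> support_vectors K n S'"
      using orbit_eq[of S' x'] x that by blast
    hence "S' = {i \<in> {0..n}. x i \<noteq> 0}"
      using support_vectors_iff[of S' n K x] that zero_in by simp
    moreover have "S = {i \<in> {0..n}. x i \<noteq> 0}"
      using support_vectors_iff[of S n K x] x(1) that zero_in by simp
    ultimately show False using that(3) by simp
  qed
  have "card (?o ` nonzero_vectors K n) = card (\<Union>S\<in>?I. ?o ` support_vectors K n S)"
    by (simp add: nonzero_vectors_eq[OF zero_in] image_UN)
  also have "\<dots> = (\<Sum>S\<in>?I. card (?o ` support_vectors K n S))"
    using disj by (intro card_UN_disjoint) (auto intro: finite_support_vectors)
  also have "\<dots> = (\<Sum>S\<in>?I. N ^ (card S - 1) * gcd (weight_gcd w S) N)"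
    by (intro sum.cong refl card_support_orbits) auto
  finally show ?thesis .
qed

end

section \<open>The orbit count over the extension of degree r\<close>

lemma CARD_gt_1: "CARD('a :: finite_field) > 1"
proof -
  have "card {0, 1 :: 'a} \<le> CARD('a)" by (intro card_mono) auto
  thus ?thesis by simp
qed

lemma twist_count_eq:
  fixes F :: "'a :: finite_field itself"
  assumes "r > 0"
  shows "twist_count F w n r = (\<Sum>S\<in>{S. S \<subseteq> {0..n} \<and> S \<noteq> {}}.
    (CARD('a) ^ r - 1) ^ (card S - 1) * gcd (weight_gcd w S) (CARD('a) ^ r - 1))"
proof -
  define N where "N = CARD('a) ^ r - 1"
  define K where "K = (field_ext r :: 'a alg_closure set)"
  have N1: "CARD('a) ^ r = Suc N" and N0: "N > 0"
    using one_less_power[OF CARD_gt_1[where 'a = 'a] assms] by (simp_all add: N_def)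
  have cK: "card K = Suc N"
    using card_field_ext[of r, where 'a = 'a] assms N1 by (simp add: K_def)
  have K0: "0 \<in> K" by (simp add: K_def field_ext_def N1)
  interpret roots_of_unity_action K N w n
  proof
    \<comment> \<open>For nonzero x, x^(N+1) = x means x^N = 1; conversely x^N = 1 excludes 0
      because N > 0.\<close>
    show "K - {0} = {x. x ^ N = 1}"
      using N0 by (auto simp: K_def field_ext_def N1 power_0_left)
    show "card (K - {0}) = N" using K0 cK by (simp add: card_Diff_singleton)
  qed (use K0 N0 in auto)
  show ?thesis
    using card_orbits by (simp add: twist_count_def Let_def K_def N_def)
qed

section \<open>Arithmetic of the exponents\<close>

text \<open>Cauchy's theorem for the additive group, taken from Sylow with exponent 1: a subgroup of
  order \<open>l\<close> contains a nonzero element killed by \<open>l\<close>, so the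
  characteristic divides the prime \<open>l\<close>.\<close>

lemma prime_dvd_CARD_finite_field:
  assumes l: "prime l" "l dvd CARD('a :: finite_field)"
  shows "l = CHAR('a)"
proof -
  define G where "G = \<lparr>carrier = (UNIV :: 'a set), monoid.mult = (+), one = (0 :: 'a)\<rparr>"
  interpret G: group G
    by (rule groupI) (auto simp: G_def add.assoc intro: left_minus)
  have pow: "x [^]\<^bsub>G\<^esub> k = of_nat k * x" for x k
    by (induction k) (simp_all add: G_def nat_pow_def algebra_simps)
  obtain m where m: "CARD('a) = l * m" using l(2) by (elim dvdE)
  have "\<exists>H. subgroup H G \<and> card H = l ^ 1"
    using m by (intro sylow_thm[OF l(1) G.is_group, where m = m]) (auto simp: G_def Coset.order_def)
  then obtain H where H: "subgroup H G" "card H = l" by auto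
  have l2: "l \<ge> 2" using l(1) by (rule prime_ge_2_nat)
  have "\<not> H \<subseteq> {0}"
    using H(2) l2 card_mono[of "{0}" H] by auto
  then obtain x where x: "x \<in> H" "x \<noteq> 0" by auto
  interpret HG: group "G\<lparr>carrier := H\<rparr>"
    using H(1) by (rule G.subgroup_imp_group)
  have "x [^]\<^bsub>G\<lparr>carrier := H\<rparr>\<^esub> Coset.order (G\<lparr>carrier := H\<rparr>) = \<one>\<^bsub>G\<lparr>carrier := H\<rparr>\<^esub>"
    using x by (intro HG.pow_order_eq_1) simp
  hence "x [^]\<^bsub>G\<^esub> l = 0"
    using H(2) by (simp add: Coset.order_def G_def nat_pow_def)
  hence "of_nat l = (0 :: 'a)" using pow x by simp
  hence "CHAR('a) dvd l" by (simp add: of_nat_eq_0_iff_char_dvd)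
  thus ?thesis
    using l(1) by (metis CHAR_not_1' One_nat_def prime_nat_iff)
qed

text \<open>Matches the condition in \<open>prime_to_divisors\<close> with the one that makes
  \<open>ord m q\<close> positive. It holds because the characteristic is the only prime factor of
  the field's cardinality.\<close>

lemma coprime_CARD_iff:
  assumes "m > 0"
  shows "coprime m CARD('a :: finite_field) \<longleftrightarrow> \<not> CHAR('a) dvd m"
proof
  assume c: "coprime m CARD('a)"
  show "\<not> CHAR('a) dvd m"
    using coprime_common_divisor_nat[OF c _ CHAR_dvd_CARD] CHAR_not_1' by auto
next
  assume *: "\<not> CHAR('a) dvd m"
  show "coprime m CARD('a)"
  proof (rule ccontr)
    assume "\<not> coprime m CARD('a)"
    hence "gcd m CARD('a) \<noteq> 1" by (simp only: coprime_iff_gcd_eq_1 not_False_eq_True)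
    then obtain l where l: "prime l" "l dvd gcd m CARD('a)"
      using prime_factor_nat by blast
    hence "l dvd m" "l dvd CARD('a)"
      by (simp_all only: gcd_greatest_iff)
    thus False using * l(1) prime_dvd_CARD_finite_field[of l, where 'a = 'a] by simp
  qed
qed

text \<open>By Euler's theorem the order of \<open>q\<close> modulo \<open>m\<close> divides the
  totient of \<open>m\<close>.\<close>

lemma twist_exponent_in_Ints:
  assumes "coprime m q"
  shows "twist_exponent q S m j \<in> \<int>"
proof -
  obtain c where c: "totient m = ord m q * c"
    using order_divides_totient[OF assms] by (elim dvdE)
  have "ord m q \<noteq> 0" using assms by (simp add: ord_eq_0)
  hence "of_nat (totient m) / of_nat (ord m q) = (of_nat c :: rat)"
    by (simp add: c)
  thus ?thesis
    unfolding twist_exponent_def by auto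
qed

text \<open>A number is the sum of the totients of its divisors, and \<open>m\<close> divides q^r -
  1 exactly when \<open>ord m q\<close> divides \<open>r\<close>.\<close>

lemma gcd_power_minus_1_eq:
  fixes q k r :: nat
  assumes cop: "\<And>m. m > 0 \<Longrightarrow> coprime m q \<longleftrightarrow> \<not> p dvd m"
    and q: "q > 1" and k: "k > 0" and r: "r > 0"
  shows "gcd k (q ^ r - 1) = (\<Sum>m\<in>prime_to_divisors p k. if ord m q dvd r then totient m else 0)"
proof -
  have q0: "q ^ r > 0" using q by simp
  have iff: "m dvd q ^ r - Suc 0 \<longleftrightarrow> ord m q dvd r" for m
    using cong_altdef_nat[of 1 "q ^ r" m] ord_divides[of q r m] q0 by (simp add: cong_sym_eq)
  have "{m. m dvd gcd k (q ^ r - 1)} = {m \<in> prime_to_divisors p k. ord m q dvd r}"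
  proof (intro equalityI subsetI)
    fix m assume m: "m \<in> {m. m dvd gcd k (q ^ r - 1)}"
    hence d: "ord m q dvd r" and m0: "m > 0" using k by (auto simp: iff dvd_pos_nat)
    \<comment> \<open>\<open>ord m q\<close> is 0 when \<open>m\<close> and \<open>q\<close> are not
      coprime, but 0 does not divide the positive \<open>r\<close>. So common divisors are
      automatically prime to \<open>p\<close>.\<close>
    hence "ord m q \<noteq> 0" using r by (intro notI) simp
    thus "m \<in> {m \<in> prime_to_divisors p k. ord m q dvd r}"
      using m m0 d cop by (auto simp: prime_to_divisors_def ord_eq_0)
  qed (auto simp: prime_to_divisors_def iff)
  moreover have "finite (prime_to_divisors p k)"
    using k by (auto simp: prime_to_divisors_def)
  ultimately show ?thesis
    using totient_divisor_sum[of "gcd k (q ^ r - 1)"] by (simp add: sum.inter_filter)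
qed

section \<open>Exponentials of formal power series\<close>

abbreviation fps_Exp :: "'b :: field_char_0 fps \<Rightarrow> 'b fps" where
  "fps_Exp f \<equiv> fps_exp 1 oo f"

lemma fps_deriv_Exp:
  fixes f :: "'b :: field_char_0 fps"
  assumes "f $ 0 = 0"
  shows "fps_deriv (fps_Exp f) = fps_Exp f * fps_deriv f"
  using assms by (simp add: fps_compose_deriv)

text \<open>The product has derivative 0, hence equals its constant term.\<close>

lemma fps_Exp_ODE_aux:
  fixes f y :: "'b :: field_char_0 fps"
  assumes "f $ 0 = 0" "fps_deriv y = y * fps_deriv f" "y $ 0 = 1"
  shows "y * fps_Exp (- f) = 1"
proof -
  have "fps_deriv (y * fps_Exp (- f)) = 0"
    using assms by (simp add: fps_deriv_Exp algebra_simps)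
  hence "y * fps_Exp (- f) = fps_const ((y * fps_Exp (- f)) $ 0)"
    by (simp only: fps_deriv_eq_0_iff)
  thus ?thesis using assms(3) by simp
qed

text \<open>Both series are inverse to \<open>fps_Exp (- f)\<close>. Sums and logarithms are then
  handled by checking a differential equation and a constant term.\<close>

lemma fps_Exp_unique:
  fixes f y :: "'b :: field_char_0 fps"
  assumes "f $ 0 = 0" "fps_deriv y = y * fps_deriv f" "y $ 0 = 1"
  shows "fps_Exp f = y"
proof -
  have 1: "fps_Exp f * fps_Exp (- f) = 1"
    using assms(1) by (intro fps_Exp_ODE_aux) (simp_all add: fps_deriv_Exp)
  have 2: "y * fps_Exp (- f) = 1"
    using assms by (rule fps_Exp_ODE_aux)
  have "fps_Exp f = fps_Exp f * (y * fps_Exp (- f))"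
    by (simp only: 2 mult_1_right)
  also have "\<dots> = fps_Exp f * fps_Exp (- f) * y"
    by (simp only: mult_ac)
  finally show ?thesis by (simp only: 1 mult_1_left)
qed

lemma fps_Exp_add:
  fixes f g :: "'b :: field_char_0 fps"
  assumes "f $ 0 = 0" "g $ 0 = 0"
  shows "fps_Exp (f + g) = fps_Exp f * fps_Exp g"
  using assms by (intro fps_Exp_unique) (simp_all add: fps_deriv_Exp algebra_simps)

lemma fps_Exp_0: "fps_Exp (0 :: 'b :: field_char_0 fps) = 1"
  by (rule fps_Exp_unique) simp_all

lemma fps_Exp_sum:
  fixes f :: "'c \<Rightarrow> 'b :: field_char_0 fps"
  assumes "\<And>x. x \<in> A \<Longrightarrow> f x $ 0 = 0"
  shows "fps_Exp (\<Sum>x\<in>A. f x) = (\<Prod>x\<in>A. fps_Exp (f x))"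
  using assms
  by (induction A rule: infinite_finite_induct)
     (simp_all add: fps_Exp_0 fps_Exp_add fps_sum_nth)

lemma fps_Exp_mult_of_nat:
  fixes f :: "'b :: field_char_0 fps"
  assumes "f $ 0 = 0"
  shows "fps_Exp (of_nat k * f) = fps_Exp f ^ k"
  using assms by (induction k) (simp_all add: fps_Exp_0 fps_Exp_add algebra_simps)

lemma fps_Exp_uminus:
  fixes f :: "'b :: field_char_0 fps"
  assumes "f $ 0 = 0"
  shows "fps_Exp (- f) = inverse (fps_Exp f)"
  using fps_Exp_add[of f "- f"] assms fps_inverse_unique[of "fps_Exp f" "fps_Exp (- f)"]
  by (simp add: fps_Exp_0)

lemma fps_Exp_mult_of_int:
  fixes f :: "'b :: field_char_0 fps"
  assumes "f $ 0 = 0"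
  shows "fps_Exp (of_int c * f) = fps_Exp f powi c"
proof (cases "c \<ge> 0")
  case True
  then obtain k where "c = int k" by (metis nonneg_int_cases)
  thus ?thesis using fps_Exp_mult_of_nat[OF assms] by simp
next
  case False
  then obtain k where k: "c = - int k" by (metis int_cases2 of_nat_0_le_iff)
  have "fps_Exp (of_int c * f) = fps_Exp (of_nat k * - f)" by (simp add: k)
  also have "\<dots> = inverse (fps_Exp f) ^ k"
    using assms by (subst fps_Exp_mult_of_nat) (simp_all add: fps_Exp_uminus)
  also have "\<dots> = fps_Exp f powi c"
    using False by (simp add: power_int_def k)
  finally show ?thesis .
qed

text \<open>
  The series \<open>- log (1 - (a t) ^ d)\<close>: for \<open>d = ord m q\<close>, it collects the
  contribution of the degrees \<open>r\<close> with \<open>m dvd q ^ r - 1\<close>. Its constant term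
  is \<open>0\<close> because of \<open>x / 0 = 0\<close>.
\<close>

definition fps_neg_log :: "nat \<Rightarrow> 'b :: field_char_0 \<Rightarrow> 'b fps" where
  "fps_neg_log d a = Abs_fps (\<lambda>r. if d dvd r then of_nat d * a ^ r / of_nat r else 0)"

lemma fps_neg_log_nth_0 [simp]: "fps_neg_log d a $ 0 = 0"
  by (simp add: fps_neg_log_def)

text \<open>The derivative of \<open>fps_neg_log d a\<close> is a geometric series with ratio (a
  t)^d, so multiplying it by P = 1 - (a t)^d leaves - P'. Thus 1/P solves the differential equation
  of the exponential.\<close>

lemma fps_Exp_neg_log:
  fixes a :: "'b :: field_char_0"
  assumes d: "d > 0"
  shows "fps_Exp (fps_neg_log d a) = inverse (1 - (fps_const a * fps_X) ^ d)"
proof (rule fps_Exp_unique)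
  define P where "P = 1 - (fps_const a * fps_X) ^ d"
  have P: "P = 1 - fps_const (a ^ d) * fps_X ^ d"
    by (simp add: P_def power_mult_distrib fps_const_power)
  have P0: "P $ 0 = 1" using d by (simp add: P)
  have "fps_deriv (fps_neg_log d a) * P = - fps_deriv P"
  proof (rule fps_ext)
    fix r
    have L: "fps_deriv (fps_neg_log d a) $ s = (if d dvd Suc s then of_nat d * a ^ Suc s else 0)" for s
      by (simp add: fps_neg_log_def del: of_nat_Suc)
    have "(fps_deriv (fps_neg_log d a) * P) $ r = (fps_deriv (fps_neg_log d a)
        - fps_const (a ^ d) * (fps_deriv (fps_neg_log d a) * fps_X ^ d)) $ r"
      by (simp add: P algebra_simps)
    also have "\<dots> = (if d dvd Suc r then of_nat d * a ^ Suc r else 0)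
        - a ^ d * (if r < d then 0 else if d dvd Suc (r - d) then of_nat d * a ^ Suc (r - d) else 0)"
      by (simp only: fps_sub_nth fps_mult_left_const_nth fps_X_power_mult_right_nth L)
    \<comment> \<open>Telescoping: from degree d on, the term and its shift by d cancel, and below
      that only degree d - 1 survives.\<close>
    also have "\<dots> = (if Suc r = d then of_nat d * a ^ d else 0)"
    proof (cases "r < d")
      case True
      hence "d dvd Suc r \<longleftrightarrow> Suc r = d" by (auto dest: dvd_imp_le)
      thus ?thesis using True by auto
    next
      case False
      then obtain s where s: "r = s + d" by (metis add.commute le_Suc_ex not_less)
      have "d dvd Suc (s + d) \<longleftrightarrow> d dvd Suc s"
        by (metis add_Suc dvd_add_left_iff dvd_refl)
      thus ?thesis using False d by (simp add: s power_add)
    qed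
    also have "\<dots> = (- fps_deriv P) $ r"
      by (auto simp: P simp del: of_nat_Suc)
    finally show "(fps_deriv (fps_neg_log d a) * P) $ r = (- fps_deriv P) $ r" .
  qed
  hence "fps_deriv (fps_neg_log d a) * (P * inverse P) = - fps_deriv P * inverse P"
    by (simp flip: mult.assoc)
  hence "fps_deriv (fps_neg_log d a) = - fps_deriv P * inverse P"
    using P0 by (simp add: inverse_mult_eq_1')
  thus "fps_deriv (inverse (1 - (fps_const a * fps_X) ^ d)) =
      inverse (1 - (fps_const a * fps_X) ^ d) * fps_deriv (fps_neg_log d a)"
    using P0 unfolding P_def[symmetric]
    by (simp add: fps_inverse_deriv power2_eq_square algebra_simps)
  show "inverse (1 - (fps_const a * fps_X) ^ d) $ 0 = 1"
    using P0 by (simp add: P_def)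
qed simp

section \<open>Rationality\<close>

lemma rational_fps_of_poly: "rational_fps (fps_of_poly P)"
  unfolding rational_fps_def by (intro exI[of _ P] exI[of _ 1]) simp

lemma rational_fps_1: "rational_fps 1"
  using rational_fps_of_poly[of 1] by simp

lemma rational_fps_mult:
  assumes "rational_fps f" "rational_fps g"
  shows "rational_fps (f * g)"
proof -
  obtain P Q P' Q' where "Q \<noteq> 0" "f * fps_of_poly Q = fps_of_poly P"
    "Q' \<noteq> 0" "g * fps_of_poly Q' = fps_of_poly P'"
    using assms unfolding rational_fps_def by blast
  moreover from this have "f * g * fps_of_poly (Q * Q') = fps_of_poly (P * P')"
    by (simp add: fps_of_poly_mult mult_ac) (metis mult.assoc mult.commute)
  ultimately show ?thesis
    unfolding rational_fps_def by (metis mult_eq_0_iff)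
qed

lemma rational_fps_prod:
  "(\<And>x. x \<in> A \<Longrightarrow> rational_fps (f x)) \<Longrightarrow> rational_fps (\<Prod>x\<in>A. f x)"
  by (induction A rule: infinite_finite_induct) (auto intro: rational_fps_1 rational_fps_mult)

lemma rational_fps_power: "rational_fps f \<Longrightarrow> rational_fps (f ^ k)"
  by (induction k) (auto intro: rational_fps_1 rational_fps_mult)

text \<open>Numerator and denominator swap roles; the nonzero constant term makes
  \<open>inverse f\<close> a true inverse, and \<open>f\<close> being nonzero makes the new
  denominator nonzero.\<close>

lemma rational_fps_inverse:
  fixes f :: "'b :: field fps"
  assumes "rational_fps f" "f $ 0 \<noteq> 0"
  shows "rational_fps (inverse f)"
proof -
  obtain P Q where PQ: "Q \<noteq> 0" "f * fps_of_poly Q = fps_of_poly P"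
    using assms unfolding rational_fps_def by blast
  have "f \<noteq> 0" using assms(2) by auto
  hence "fps_of_poly P \<noteq> 0" using PQ(1) by (simp flip: PQ(2))
  hence "P \<noteq> 0" by auto
  moreover have "inverse f * fps_of_poly P = fps_of_poly Q"
    using assms(2) by (simp add: inverse_mult_eq_1 flip: PQ(2) mult.assoc)
  ultimately show ?thesis unfolding rational_fps_def by blast
qed

lemma rational_fps_powi:
  fixes f :: "'b :: field fps"
  assumes "rational_fps f" "f $ 0 \<noteq> 0"
  shows "rational_fps (f powi c)"
  using assms by (simp add: power_int_def rational_fps_power rational_fps_inverse)

section \<open>The zeta function\<close>

theorem theorem6p1:
  fixes F :: "'a :: finite_field itself" and p q n :: nat and w :: "nat \<Rightarrow> nat"
  assumes p: "p = CHAR('a)" and q: "q = CARD('a)"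
    and w: "\<And>i. i \<in> {0..n} \<Longrightarrow> w i > 0"
  shows "rational_fps (twist_zeta F w n) \<and>
    (\<forall>S m j. S \<subseteq> {0..n} \<and> S \<noteq> {} \<and> m \<in> prime_to_divisors p (weight_gcd w S) \<and>
       j \<in> {0..card S - 1} \<longrightarrow> twist_exponent q S m j \<in> \<int>) \<and>
    twist_zeta F w n =
      (\<Prod>S\<in>{S. S \<subseteq> {0..n} \<and> S \<noteq> {}}. \<Prod>m\<in>prime_to_divisors p (weight_gcd w S).
         \<Prod>j\<in>{0..card S - 1}.
           (1 - (fps_const (of_nat q ^ j) * fps_X) ^ ord m q)
             powi (- \<lfloor>twist_exponent q S m j\<rfloor>))"
proof -
  let ?I = "{S. S \<subseteq> {0..n} \<and> S \<noteq> {}}"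
  let ?D = "\<lambda>S. prime_to_divisors p (weight_gcd w S)"
  let ?c = "twist_exponent q"
  \<comment> \<open>For \<open>m\<close> prime to \<open>q\<close>, \<open>fps_Exp (L m j)\<close>
    is the inverse of \<open>P m j\<close>.\<close>
  define L where "L = (\<lambda>m j. fps_neg_log (ord m q) (of_nat q ^ j :: rat))"
  define P where "P = (\<lambda>m j. 1 - (fps_const (of_nat q ^ j :: rat) * fps_X) ^ ord m q)"
  have q1: "q > 1" unfolding q by (rule CARD_gt_1)
  have cop: "coprime m q \<longleftrightarrow> \<not> p dvd m" if "m > 0" for m
    unfolding p q using that by (rule coprime_CARD_iff)
  have copD: "coprime m q" if "m \<in> prime_to_divisors p k" for m k
    using that cop by (auto simp: prime_to_divisors_def)
  have kpos: "weight_gcd w S > 0" if "S \<in> ?I" for S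
  proof -
    \<comment> \<open>The gcd divides a positive weight, so it is positive.\<close>
    obtain i where "i \<in> S" "w i > 0" using \<open>S \<in> ?I\<close> w by blast
    thus ?thesis unfolding weight_gcd_def by (metis Gcd_dvd dvd_pos_nat imageI)
  qed
  have int: "?c S m j \<in> \<int>" if "m \<in> prime_to_divisors p k" for S m j k
    using copD[OF that] by (rule twist_exponent_in_Ints)
  have P0: "P m j $ 0 = 1" if "coprime m q" for m j
    using that by (simp add: P_def fps_power_zeroth ord_eq_0)

  have count: "of_nat (twist_count F w n r) / of_nat r =
      (\<Sum>S\<in>?I. \<Sum>m\<in>?D S. \<Sum>j\<in>{0..card S - 1}. ?c S m j * L m j $ r)" if r: "r > 0" for r
  proof -
    define x where "x = (of_nat q ^ r :: rat)"
    \<comment> \<open>The natural subtraction is exact since q^r is at least 1.\<close>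
    have qr: "of_nat (q ^ r - 1) = x - 1"
      using q1 by (simp add: of_nat_diff x_def)
    have "of_nat (twist_count F w n r) = (\<Sum>S\<in>?I. (x - 1) ^ (card S - 1) *
        of_nat (gcd (weight_gcd w S) (q ^ r - 1)))"
      unfolding twist_count_eq[OF r] q[symmetric] by (simp only: of_nat_sum of_nat_mult of_nat_power qr)
    also have "\<dots> = (\<Sum>S\<in>?I. \<Sum>m\<in>?D S. (x - 1) ^ (card S - 1) *
        (if ord m q dvd r then of_nat (totient m) else 0))"
    proof (intro sum.cong refl)
      fix S assume S: "S \<in> ?I"
      have g: "gcd (weight_gcd w S) (q ^ r - 1) =
          (\<Sum>m\<in>?D S. if ord m q dvd r then totient m else 0)"
        using cop q1 kpos[OF S] r by (rule gcd_power_minus_1_eq)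
      show "(x - 1) ^ (card S - 1) * of_nat (gcd (weight_gcd w S) (q ^ r - 1)) =
        (\<Sum>m\<in>?D S. (x - 1) ^ (card S - 1) * (if ord m q dvd r then of_nat (totient m) else 0))"
        unfolding g of_nat_sum sum_distrib_left
        by (intro sum.cong refl) simp
    qed
    finally have "of_nat (twist_count F w n r) / of_nat r =
        (\<Sum>S\<in>?I. \<Sum>m\<in>?D S. (x - 1) ^ (card S - 1) *
        (if ord m q dvd r then of_nat (totient m) else 0) / of_nat r)"
      by (simp only: sum_divide_distrib)
    also have "\<dots> = (\<Sum>S\<in>?I. \<Sum>m\<in>?D S. \<Sum>j\<in>{0..card S - 1}. ?c S m j * L m j $ r)"
    proof (intro sum.cong refl)
      fix S m assume m: "m \<in> ?D S"
      have o0: "ord m q \<noteq> 0" using copD[OF m] by (simp add: ord_eq_0)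
      have bin: "(x - 1) ^ (card S - 1) = (\<Sum>j\<in>{0..card S - 1}.
          of_nat ((card S - 1) choose j) * x ^ j * (- 1) ^ (card S - 1 - j))"
        using binomial_ring[of x "- 1" "card S - 1"] by (simp add: atLeast0AtMost)
      \<comment> \<open>Regrouping (q^r)^j as (q^j)^r turns the binomial terms into coefficients of
        series in q^j t.\<close>
      have xq: "x ^ j = (of_nat q ^ j) ^ r" for j
        by (simp add: x_def mult.commute flip: power_mult)
      \<comment> \<open>The denominator \<open>ord m q\<close> of the exponent cancels against the
        factor d in \<open>fps_neg_log\<close>.\<close>
      have "of_nat ((card S - 1) choose j) * x ^ j * (- 1) ^ (card S - 1 - j) *
          (if ord m q dvd r then of_nat (totient m) else 0) / of_nat r = ?c S m j * L m j $ r" for j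
        unfolding xq L_def using o0 by (simp add: fps_neg_log_def twist_exponent_def)
      thus "(x - 1) ^ (card S - 1) *
          (if ord m q dvd r then of_nat (totient m) else 0) / of_nat r =
          (\<Sum>j\<in>{0..card S - 1}. ?c S m j * L m j $ r)"
        by (simp only: bin sum_distrib_right sum_divide_distrib)
    qed
    finally show ?thesis .
  qed

  \<comment> \<open>Degree 0 holds because every \<open>L m j\<close> has constant term 0; that also
    allows the exponential to turn the sum into a product.\<close>
  have "Abs_fps (\<lambda>r. if r = 0 then 0 else of_nat (twist_count F w n r) / of_nat r) =
      (\<Sum>S\<in>?I. \<Sum>m\<in>?D S. \<Sum>j\<in>{0..card S - 1}. fps_const (?c S m j) * L m j)"
    by (rule fps_ext) (simp add: count fps_sum_nth L_def)
  hence "twist_zeta F w n =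
      (\<Prod>S\<in>?I. \<Prod>m\<in>?D S. \<Prod>j\<in>{0..card S - 1}. fps_Exp (fps_const (?c S m j) * L m j))"
    unfolding twist_zeta_def by (simp add: fps_Exp_sum fps_sum_nth L_def)
  also have "\<dots> = (\<Prod>S\<in>?I. \<Prod>m\<in>?D S. \<Prod>j\<in>{0..card S - 1}. P m j powi (- \<lfloor>?c S m j\<rfloor>))"
  proof (intro prod.cong refl)
    fix S m j assume m: "m \<in> ?D S"
    have Z: "P m j $ 0 = 1" using copD[OF m] by (rule P0)
    \<comment> \<open>Integrality makes the exponential of a multiple of \<open>L m j\<close> an
      integer power.\<close>
    have "fps_const (?c S m j) = of_int \<lfloor>?c S m j\<rfloor>"
      using int[OF m, of S j] by (metis Ints_cases floor_of_int fps_of_int)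
    hence "fps_Exp (fps_const (?c S m j) * L m j) = fps_Exp (L m j) powi \<lfloor>?c S m j\<rfloor>"
      by (simp add: fps_Exp_mult_of_int L_def)
    also have "fps_Exp (L m j) = inverse (P m j)"
      unfolding L_def P_def using copD[OF m] by (intro fps_Exp_neg_log) simp
    \<comment> \<open>Constant term 1 makes inversion of \<open>P m j\<close> an involution.\<close>
    also have "inverse (P m j) powi c = P m j powi (- c)" for c
      using Z by (auto simp: power_int_def fps_inverse_idempotent)
    finally show "fps_Exp (fps_const (?c S m j) * L m j) = P m j powi (- \<lfloor>?c S m j\<rfloor>)" .
  qed
  finally have eq: "twist_zeta F w n = \<dots>" .
  \<comment> \<open>Each factor is a polynomial, so the finite product of their integer powers is
    rational.\<close>
  have "P m j = fps_of_poly (1 - [:0, of_nat q ^ j:] ^ ord m q)" for m j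
    by (simp add: P_def fps_of_poly_diff fps_of_poly_power fps_of_poly_pCons)
  hence "rational_fps (P m j)" for m j
    by (simp add: rational_fps_of_poly)
  hence "rational_fps (twist_zeta F w n)"
    unfolding eq using P0 copD by (intro rational_fps_prod rational_fps_powi) auto
  thus ?thesis
    using eq int unfolding P_def by blast
qed

end
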